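(* Let $K$ be a number field with ring of integers $\mathcal{O}_K$, let $f\in\mathcal{O}_K[x,y]$ be a binary form of degree $d\ge2$, and let $\mathfrak p=\xi(f)=[\xi_0,\dots,\xi_n]\in\mathbb{WP}^n_{\mathbf w}(\mathcal{O}_K)$, with $\xi_i=\xi_i(f)$ and weights $\mathbf w=(q_0,\dots,q_n)$, be its moduli point (so the $\xi_i$ lie in $\mathcal{O}_K$ and are not all zero). Assume that $\mathfrak p$ is normalized. For each prime $p\in\mathcal{O}_K$ with $p\mid\gcd(\xi_0,\dots,\xi_n)$ let $\alpha_p=\min\{v_p(\xi_i):0\le i\le n,\ \xi_i\ne0\}$, let $j=j(p)$ be an index with $\xi_j\ne0$ and $v_p(\xi_j)=\alpha_p$, and let $r_p=\frac{2\alpha_p}{d\,q_j}$. Then $f^M$ is semistable over $K$ for $$M=\begin{bmatrix}\dfrac1\lambda&0\\0&1\end{bmatrix},\qquad \lambda=\prod_{p\mid\gcd(\xi_0,\dots,\xi_n)}p^{r_p},$$ where the product runs over the primes $p\in\mathcal{O}_K$ (up to associates) dividing all of $\xi_0,\dots,\xi_n$.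
   Context: A binary form of degree $d$ is $f(x,y)=\sum_{i=0}^d a_ix^iy^{d-i}$. For $M=\begin{bmatrix}a&b\\c&d'\end{bmatrix}\in\mathrm{GL}_2$, $f^M(x,y)=f(ax+by,cx+d'y)$. The elements $\xi_0,\dots,\xi_n$ are a fixed minimal set of homogeneous generators, of degrees $q_0,\dots,q_n$ and chosen with integer coefficients, of the ring of $\mathrm{SL}_2$-invariants (polynomials in $a_0,\dots,a_d$) of binary forms of degree $d$; $\xi_i(f)$ is the value of $\xi_i$ at $f$. $\mathbb{WP}^n_{\mathbf w}$ is the weighted projective space, where $(x_0,\dots,x_n)\neq 0$ is identified with $(\lambda^{q_0}x_0,\dots,\lambda^{q_n}x_n)$ for nonzero $\lambda$. The point $\mathfrak p=[\xi_0,\dots,\xi_n]$ with coordinates in $\mathcal{O}_K$ is normalized if its weighted greatest common divisor is $1$, i.e. there is no non-unit $c\in\mathcal{O}_K$ with $c^{q_i}\mid\xi_i$ for all $i$. For a prime element $p\in\mathcal{O}_K$, $v_p$ denotes the exponent of $p$ (the $p$-adic valuation normalized by $v_p(p)=1$), extended to a fixed valuation on $\overline K$. Here $p^r$ for rational $r$ denotes a choice of $r$-th power of $p$ in $\overline K$ (so $M\in\mathrm{GL}_2(\overline K)$ in general), and $K_p$ is the completion of $K$ at $p$. "$p\mid\gcd(\xi_0,\dots,\xi_n)$" means that $p$ divides every $\xi_i$. A form $g$ (with the tuple $\xi_0(g),\dots,\xi_n(g)$) is semistable over $K_p$ if some coordinate $\xi_i(g)$ is nonzero modulo $p$, i.e.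 $v_p(\xi_i(g))\le0$ for some $i$. It is semistable over $K$ if it is semistable over $K_p$ for every prime $p\in\mathcal{O}_K$. *)

theory Defs
  imports
    "HOL-Library.Poly_Mapping"
    "HOL-Library.Extended_Real"
    "HOL-Algebra.Algebraic_Closure_Type"
    "Jordan_Normal_Form.Char_Poly"
begin

class number_field = field_char_0 +
  assumes finite_over_rat:
    "\<exists>B. finite B \<and> (\<forall>x. \<exists>c :: 'a \<Rightarrow> rat. x = (\<Sum>b\<in>B. of_rat (c b) * b))"

instance rat :: number_field
proof
  have "\<forall>x. \<exists>c :: rat \<Rightarrow> rat. x = (\<Sum>b\<in>{1}. of_rat (c b) * b)"
    by (auto intro: exI[of _ "\<lambda>_. x" for x])
  then show "\<exists>B. finite B \<and> (\<forall>x. \<exists>c :: rat \<Rightarrow> rat. x = (\<Sum>b\<in>B. of_rat (c b) * b))"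
    by (intro exI[of _ "{1}"]) simp
qed

definition int_lincomb :: "('i \<Rightarrow> 'a :: ring_1) \<Rightarrow> 'i set \<Rightarrow> 'a set" where
  "int_lincomb w I = range (\<lambda>c. \<Sum>i\<in>I. of_int (c i) * w i)"

lemma int_lincomb_0: "0 \<in> int_lincomb w I"
  unfolding int_lincomb_def by (rule range_eqI[of _ _ "\<lambda>_. 0"]) simp

lemma int_lincomb_add:
  assumes "a \<in> int_lincomb w I" "b \<in> int_lincomb w I"
  shows "a + b \<in> int_lincomb w I"
proof -
  from assms obtain c e where "a = (\<Sum>i\<in>I. of_int (c i) * w i)" "b = (\<Sum>i\<in>I. of_int (e i) * w i)"
    by (auto simp: int_lincomb_def)
  then show ?thesis unfolding int_lincomb_def
    by (intro range_eqI[of _ _ "\<lambda>i. c i + e i"]) (simp add: sum.distrib algebra_simps)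
qed

lemma int_lincomb_scale:
  assumes "a \<in> int_lincomb w I"
  shows "of_int k * a \<in> int_lincomb w I"
proof -
  from assms obtain c where "a = (\<Sum>i\<in>I. of_int (c i) * w i)"
    by (auto simp: int_lincomb_def)
  then show ?thesis unfolding int_lincomb_def
    by (intro range_eqI[of _ _ "\<lambda>i. k * c i"]) (simp add: sum_distrib_left mult.assoc)
qed

lemma int_lincomb_sum:
  assumes "\<And>i. i \<in> J \<Longrightarrow> g i \<in> int_lincomb w I"
  shows "(\<Sum>i\<in>J. of_int (c i) * g i) \<in> int_lincomb w I"
  using assms
  by (induction J rule: infinite_finite_induct)
     (auto intro: int_lincomb_0 int_lincomb_add int_lincomb_scale)

lemma int_lincomb_base:
  assumes "finite I" "i \<in> I"
  shows "w i \<in> int_lincomb w I"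
proof -
  have "(\<Sum>j\<in>I. of_int (if j = i then 1 else 0) * w j) = (\<Sum>j\<in>I. if j = i then w j else 0)"
    by (intro sum.cong) auto
  also have "\<dots> = w i" using assms by simp
  finally show ?thesis unfolding int_lincomb_def by (intro range_eqI[of _ _ "\<lambda>j. if j = i then 1 else 0"]) simp
qed

lemma algebraic_int_if_stable_lattice:
  fixes z :: "'a :: field_char_0"
  assumes fin: "finite I" and i0: "i0 \<in> I" "w i0 \<noteq> 0"
    and stable: "\<And>i. i \<in> I \<Longrightarrow> z * w i \<in> int_lincomb w I"
  shows "algebraic_int z"
proof -
  define n where "n = card I"
  obtain h where h: "bij_betw h {..<n} I"
    using ex_bij_betw_nat_finite[OF fin] by (auto simp: n_def lessThan_atLeast0)
  have "\<forall>i\<in>I. \<exists>c. z * w i = (\<Sum>j\<in>I. of_int (c j) * w j)"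
    using stable by (auto simp: int_lincomb_def)
  then obtain c where c: "\<And>i. i \<in> I \<Longrightarrow> z * w i = (\<Sum>j\<in>I. of_int (c i j) * w j)"
    by metis
  define A :: "int mat" where "A = mat n n (\<lambda>(k, l). c (h k) (h l))"
  define B :: "'a mat" where "B = map_mat of_int A"
  define u where "u = vec n (\<lambda>k. w (h k))"
  have A: "A \<in> carrier_mat n n" and B: "B \<in> carrier_mat n n" by (auto simp: A_def B_def)
  have hI: "h k \<in> I" if "k < n" for k
    using h that by (auto simp: bij_betw_def)
  have "B *\<^sub>v u = z \<cdot>\<^sub>v u"
  proof (rule eq_vecI)
    fix k assume "k < dim_vec (z \<cdot>\<^sub>v u)"
    then have k: "k < n" by (simp add: u_def)
    have "(B *\<^sub>v u) $ k = (\<Sum>l<n. of_int (c (h k) (h l)) * w (h l))"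
      using k by (simp add: A_def B_def u_def scalar_prod_def lessThan_atLeast0)
    also have "\<dots> = (\<Sum>j\<in>I. of_int (c (h k) j) * w j)"
      by (rule sum.reindex_bij_betw[OF h])
    also have "\<dots> = z * w (h k)" using c[OF hI[OF k]] by simp
    finally show "(B *\<^sub>v u) $ k = (z \<cdot>\<^sub>v u) $ k" using k by (simp add: u_def)
  qed (simp add: u_def B_def A_def)
  moreover have "u \<noteq> 0\<^sub>v n"
  proof
    assume u0: "u = 0\<^sub>v n"
    from h i0 obtain k where k: "k < n" "h k = i0" by (auto simp: bij_betw_def)
    then have "u $ k = w i0" by (simp add: u_def)
    with u0 k i0 show False by simp
  qed
  ultimately have "eigenvalue B z"
    using B unfolding eigenvalue_def eigenvector_def
    by (intro exI[of _ u]) (auto simp: u_def)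
  then have "poly (char_poly B) z = 0"
    using eigenvalue_root_char_poly[OF B] by simp
  then have "poly (map_poly of_int (char_poly A)) z = 0"
    unfolding B_def by (subst (asm) of_int_hom.char_poly_hom[OF A])
  moreover have "lead_coeff (char_poly A) = 1"
    using degree_monic_char_poly[OF A] by simp
  ultimately show ?thesis by (auto simp: algebraic_int_altdef_ipoly)
qed

lemma algebraic_int_monic_relation:
  fixes x :: "'a :: field_char_0"
  assumes "algebraic_int x"
  obtains m and c :: "nat \<Rightarrow> int" where "m > 0" "x ^ m = (\<Sum>i<m. of_int (c i) * x ^ i)"
proof -
  from assms obtain p where p: "poly (map_poly of_int p) x = 0" "lead_coeff p = 1"
    by (auto simp: algebraic_int_altdef_ipoly)
  define m where "m = degree p"
  have deg: "degree (map_poly of_int p :: 'a poly) = m" by (simp add: m_def)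
  have "0 = (\<Sum>i\<le>m. of_int (coeff p i) * x ^ i)"
    using p(1) by (simp add: poly_altdef m_def)
  also have "\<dots> = (\<Sum>i<m. of_int (coeff p i) * x ^ i) + x ^ m"
    using p(2) by (simp add: lessThan_Suc_atMost[symmetric] m_def)
  finally have *: "x ^ m = (\<Sum>i<m. of_int (- coeff p i) * x ^ i)"
    by (simp add: sum_negf eq_neg_iff_add_eq_0 add.commute)
  have "m > 0"
    using * by (cases m) auto
  with * show thesis by (intro that[of m "\<lambda>i. - coeff p i"]) auto
qed

lemma algebraic_int_add_mult:
  fixes x y :: "'a :: field_char_0"
  assumes "algebraic_int x" "algebraic_int y"
  shows "algebraic_int (x + y)" "algebraic_int (x * y)"
proof -
  obtain m c where m: "m > 0" "x ^ m = (\<Sum>i<m. of_int (c i) * x ^ i)"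
    using algebraic_int_monic_relation[OF assms(1)] by blast
  obtain n e where n: "n > 0" "y ^ n = (\<Sum>i<n. of_int (e i) * y ^ i)"
    using algebraic_int_monic_relation[OF assms(2)] by blast
  define I where "I = {..<m} \<times> {..<n}"
  define w where "w = (\<lambda>(i, j). x ^ i * y ^ j)"
  let ?S = "int_lincomb w I"
  have fin: "finite I" by (simp add: I_def)
  have base: "x ^ i * y ^ j \<in> ?S" if "i < m" "j < n" for i j
    using int_lincomb_base[OF fin, of "(i, j)" w] that by (simp add: I_def w_def)
  have xw: "x * w k \<in> ?S" if kI: "k \<in> I" for k
  proof -
    obtain i j where k: "k = (i, j)" "i < m" "j < n" using kI by (cases k) (auto simp: I_def)
    show ?thesis
    proof (cases "Suc i < m")
      case True
      then show ?thesis using base[of "Suc i" j] k by (simp add: w_def mult.assoc)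
    next
      case False
      with k have "Suc i = m" by simp
      then have "x * w k = x ^ m * y ^ j"
        using k by (auto simp: w_def mult.assoc)
      also have "\<dots> = (\<Sum>i<m. of_int (c i) * (x ^ i * y ^ j))"
        by (simp add: m(2) sum_distrib_right mult.assoc)
      also have "\<dots> \<in> ?S" by (rule int_lincomb_sum) (use base k in auto)
      finally show ?thesis .
    qed
  qed
  have yw: "y * w k \<in> ?S" if kI: "k \<in> I" for k
  proof -
    obtain i j where k: "k = (i, j)" "i < m" "j < n" using kI by (cases k) (auto simp: I_def)
    show ?thesis
    proof (cases "Suc j < n")
      case True
      then show ?thesis using base[of i "Suc j"] k by (simp add: w_def mult_ac)
    next
      case False
      with k have "Suc j = n" by simp
      then have "y * w k = x ^ i * y ^ n"
        using k by (auto simp: w_def mult_ac)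
      also have "\<dots> = (\<Sum>j<n. of_int (e j) * (x ^ i * y ^ j))"
        by (simp add: n(2) sum_distrib_left mult_ac)
      also have "\<dots> \<in> ?S" by (rule int_lincomb_sum) (use base k in auto)
      finally show ?thesis .
    qed
  qed
  have xS: "x * s \<in> ?S" if "s \<in> ?S" for s
  proof -
    from that obtain g where "s = (\<Sum>k\<in>I. of_int (g k) * w k)" by (auto simp: int_lincomb_def)
    then have "x * s = (\<Sum>k\<in>I. of_int (g k) * (x * w k))"
      by (simp add: sum_distrib_left mult_ac)
    then show ?thesis using int_lincomb_sum[of I "\<lambda>k. x * w k" w I g] xw by simp
  qed
  have i0: "(0, 0) \<in> I" "w (0, 0) \<noteq> 0" using m n by (auto simp: I_def w_def)
  show "algebraic_int (x + y)"
    by (rule algebraic_int_if_stable_lattice[where w = w, OF fin i0])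
       (simp only: distrib_right int_lincomb_add xw yw)
  show "algebraic_int (x * y)"
    by (rule algebraic_int_if_stable_lattice[where w = w, OF fin i0])
       (simp only: mult.assoc xS yw)
qed

typedef (overloaded) 'k int_ring = "{x :: 'k :: field_char_0. algebraic_int x}"
  morphisms of_int_ring Abs_int_ring
  by (rule exI[of _ 0]) simp

lemma algebraic_int_of_int_ring: "algebraic_int (of_int_ring x)"
  using of_int_ring[of x] by simp

instantiation int_ring :: (field_char_0) idom
begin

definition "0 = Abs_int_ring 0"
definition "1 = Abs_int_ring 1"
definition "x + y = Abs_int_ring (of_int_ring x + of_int_ring y)"
definition "x * y = Abs_int_ring (of_int_ring x * of_int_ring y)"
definition "- x = Abs_int_ring (- of_int_ring x)"
definition "x - y = Abs_int_ring (of_int_ring x - of_int_ring y)"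

lemma of_int_ring_simps:
  "of_int_ring 0 = 0" "of_int_ring 1 = 1"
  "of_int_ring (x + y) = of_int_ring x + of_int_ring y"
  "of_int_ring (x * y) = of_int_ring x * of_int_ring y"
  "of_int_ring (- x) = - of_int_ring x"
  "of_int_ring (x - y) = of_int_ring x - of_int_ring y"
proof -
  have "algebraic_int (of_int_ring x - of_int_ring y)"
    using algebraic_int_add_mult(1)[of "of_int_ring x" "- of_int_ring y"]
    by (simp add: algebraic_int_of_int_ring)
  then show "of_int_ring (x - y) = of_int_ring x - of_int_ring y"
    by (simp add: minus_int_ring_def Abs_int_ring_inverse)
qed (simp_all add: zero_int_ring_def one_int_ring_def plus_int_ring_def times_int_ring_def
      uminus_int_ring_def Abs_int_ring_inverse algebraic_int_add_mult algebraic_int_of_int_ring)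

instance
  by standard (simp_all add: of_int_ring_inject[symmetric] of_int_ring_simps algebra_simps)

end

definition int_to_ac :: "'k :: field_char_0 int_ring \<Rightarrow> 'k alg_closure" where
  "int_to_ac x = to_ac (of_int_ring x)"

definition is_valuation :: "('a :: field \<Rightarrow> ereal) \<Rightarrow> bool" where
  "is_valuation w \<longleftrightarrow>
     w 0 = \<infinity> \<and> (\<forall>x. x \<noteq> 0 \<longrightarrow> \<bar>w x\<bar> \<noteq> \<infinity>) \<and>
     (\<forall>x y. w (x * y) = w x + w y) \<and> (\<forall>x y. min (w x) (w y) \<le> w (x + y))"

text \<open>In the integers of a number field the set is finite if \<open>p\<close> is not a unit and \<open>x \<noteq> 0\<close>. The library's
  \<open>multiplicity\<close> requires unique factorization of elements.\<close>

definition p_exponent :: "'a :: comm_semiring_1 \<Rightarrow> 'a \<Rightarrow> nat" where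
  "p_exponent p x = Max {k. p ^ k dvd x}"

definition p_val :: "'k :: field_char_0 int_ring \<Rightarrow> 'k int_ring \<Rightarrow> ereal" where
  "p_val p x = (if x = 0 then \<infinity> else ereal (real (p_exponent p x)))"

text \<open>Every nonzero element of the field is a quotient of integers, so agreement with \<open>p_val p\<close> on
  the ring of integers is agreement with the \<open>p\<close>-adic valuation on the whole field.\<close>

definition extends_p_val :: "'k :: field_char_0 int_ring \<Rightarrow> ('k alg_closure \<Rightarrow> ereal) \<Rightarrow> bool" where
  "extends_p_val p w \<longleftrightarrow> is_valuation w \<and> (\<forall>x. w (int_to_ac x) = p_val p x)"

text \<open>For \<open>r = a / b\<close> in lowest terms, an \<open>r\<close>-th power of \<open>x\<close> is a \<open>b\<close>-th root of \<open>x\<^sup>a\<close>.\<close>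

definition is_rat_power :: "'a :: field \<Rightarrow> rat \<Rightarrow> 'a \<Rightarrow> bool" where
  "is_rat_power x r z \<longleftrightarrow> (case quotient_of r of (a, b) \<Rightarrow> z ^ nat b = x powi a)"

type_synonym 'a mpoly = "(nat \<Rightarrow>\<^sub>0 nat) \<Rightarrow>\<^sub>0 'a"

definition Const :: "'a :: comm_ring_1 \<Rightarrow> 'a mpoly" where
  "Const c = Poly_Mapping.single 0 c"

definition Var :: "nat \<Rightarrow> 'a :: comm_ring_1 mpoly" where
  "Var i = Poly_Mapping.single (Poly_Mapping.single i 1) 1"

text \<open>The coefficients are mapped into the target ring by \<open>h\<close>, and \<open>s i\<close> is substituted for the
  variable with number \<open>i\<close>.\<close>

definition eval_mpoly :: "('a :: zero \<Rightarrow> 'b :: comm_ring_1) \<Rightarrow> (nat \<Rightarrow> 'b) \<Rightarrow> 'a mpoly \<Rightarrow> 'b" where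
  "eval_mpoly h s p =
     (\<Sum>m\<in>Poly_Mapping.keys p. h (Poly_Mapping.lookup p m) *
        (\<Prod>i\<in>Poly_Mapping.keys m. s i ^ Poly_Mapping.lookup m i))"

definition homogeneous :: "nat \<Rightarrow> 'a :: zero mpoly \<Rightarrow> bool" where
  "homogeneous q p \<longleftrightarrow>
     (\<forall>m\<in>Poly_Mapping.keys p. (\<Sum>i\<in>Poly_Mapping.keys m. Poly_Mapping.lookup m i) = q)"

inductive_set subalgebra_generated :: "'a :: comm_ring_1 mpoly set \<Rightarrow> 'a mpoly set"
  for S :: "'a mpoly set" where
  gen_const: "Const c \<in> subalgebra_generated S"
| gen_base: "p \<in> S \<Longrightarrow> p \<in> subalgebra_generated S"
| gen_add: "p \<in> subalgebra_generated S \<Longrightarrow> p' \<in> subalgebra_generated S \<Longrightarrow>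
    p + p' \<in> subalgebra_generated S"
| gen_mult: "p \<in> subalgebra_generated S \<Longrightarrow> p' \<in> subalgebra_generated S \<Longrightarrow>
    p * p' \<in> subalgebra_generated S"

text \<open>In a form, \<open>Var 0\<close> plays the role of \<open>x\<close> and \<open>Var 1\<close> that of \<open>y\<close>; in an invariant, \<open>Var i\<close>
  is the coefficient \<open>a\<^sub>i\<close> of \<open>x\<^sup>i y\<^bsup>d-i\<^esup>\<close>.\<close>

definition is_binary_form :: "nat \<Rightarrow> 'a :: comm_ring_1 mpoly \<Rightarrow> bool" where
  "is_binary_form d f \<longleftrightarrow> (\<exists>a. f = (\<Sum>i\<le>d. Const (a i) * Var 0 ^ i * Var 1 ^ (d - i)))"

definition form_coeff :: "nat \<Rightarrow> 'a :: zero mpoly \<Rightarrow> nat \<Rightarrow> 'a" where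
  "form_coeff d f i =
     Poly_Mapping.lookup f (Poly_Mapping.single 0 i + Poly_Mapping.single 1 (d - i))"

definition form_subst :: "'a :: comm_ring_1 mat \<Rightarrow> 'a mpoly \<Rightarrow> 'a mpoly" where
  "form_subst M f =
     eval_mpoly Const (\<lambda>i. Const (M $$ (i, 0)) * Var 0 + Const (M $$ (i, 1)) * Var 1) f"

definition SL2 :: "'a :: comm_ring_1 mat set" where
  "SL2 = {N \<in> carrier_mat 2 2. det N = 1}"

text \<open>Invariance is tested on values, which over an infinite field is the same as the polynomial
  identity.\<close>

definition sl2_invariants :: "nat \<Rightarrow> 'a :: field mpoly set" where
  "sl2_invariants d =
     {I. (\<forall>m\<in>Poly_Mapping.keys I. Poly_Mapping.keys m \<subseteq> {..d}) \<and>
         (\<forall>g N. is_binary_form d g \<longrightarrow> N \<in> SL2 \<longrightarrow>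
            eval_mpoly id (form_coeff d (form_subst N g)) I = eval_mpoly id (form_coeff d g) I)}"

definition minimal_homogeneous_generators ::
    "nat \<Rightarrow> nat \<Rightarrow> (nat \<Rightarrow> nat) \<Rightarrow> (nat \<Rightarrow> 'a :: field mpoly) \<Rightarrow> bool" where
  "minimal_homogeneous_generators d n q I \<longleftrightarrow>
     (\<forall>i\<le>n. homogeneous (q i) (I i)) \<and>
     subalgebra_generated (I ` {..n}) = sl2_invariants d \<and>
     (\<forall>k\<le>n. subalgebra_generated (I ` ({..n} - {k})) \<noteq> sl2_invariants d)"

definition inv_value :: "nat \<Rightarrow> int mpoly \<Rightarrow> 'a :: comm_ring_1 mpoly \<Rightarrow> 'a" where
  "inv_value d I g = eval_mpoly of_int (form_coeff d g) I"

definition normalized :: "nat \<Rightarrow> (nat \<Rightarrow> nat) \<Rightarrow> (nat \<Rightarrow> 'a :: comm_ring_1) \<Rightarrow> bool" where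
  "normalized n q x \<longleftrightarrow> \<not> (\<exists>c. \<not> c dvd 1 \<and> (\<forall>i\<le>n. c ^ q i dvd x i))"

definition semistable_at ::
    "('a \<Rightarrow> ereal) \<Rightarrow> nat \<Rightarrow> nat \<Rightarrow> (nat \<Rightarrow> int mpoly) \<Rightarrow> 'a :: field mpoly \<Rightarrow> bool" where
  "semistable_at w d n \<xi> g \<longleftrightarrow> (\<exists>i\<le>n. w (inv_value d (\<xi> i) g) \<le> 0)"

text \<open>\<open>v p\<close> is the chosen extension of the \<open>p\<close>-adic valuation to the algebraic closure.\<close>

definition semistable ::
    "('k :: field_char_0 int_ring \<Rightarrow> 'k alg_closure \<Rightarrow> ereal) \<Rightarrow> nat \<Rightarrow> nat \<Rightarrow>
     (nat \<Rightarrow> int mpoly) \<Rightarrow> 'k alg_closure mpoly \<Rightarrow> bool" where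
  "semistable v d n \<xi> g \<longleftrightarrow> (\<forall>p. prime_elem p \<longrightarrow> semistable_at (v p) d n \<xi> g)"

end

(* Let \<mu>^2 = \<lambda>. Then diag(1/\<lambda>, 1) = (1/\<mu>) diag(1/\<mu>, \<mu>) with the second factor in SL2, so an invariant
   of degree q satisfies \<xi>(f^M) = \<mu>^(-dq) \<xi>(f). At a prime p dividing all coordinates v_p(\<lambda>) = r_p,
   and the coordinate j(p) gets valuation \<alpha>_p - (d q_j / 2) r_p = 0; at every other prime v_p(\<lambda>) = 0
   and a coordinate prime to p stays so. The product defining \<lambda> needs finitely many primes (an
   infinite product is 1 by convention), which follows from finiteness of the degree of the field. *)

theory Submission
  imports Defs
begin

section \<open>The ring of integers inside its field\<close>

lemma of_int_ring_of_nat: "of_int_ring (of_nat n) = of_nat n"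
  by (induction n) (simp_all add: of_int_ring_simps)

text \<open>Characteristic 0 allows nonzero integers to be cancelled in the ring of integers, as
  happens when \<open>primitive_integer_relation\<close> is applied there.\<close>

instance int_ring :: (field_char_0) ring_char_0
proof
  show "inj (of_nat :: nat \<Rightarrow> 'a int_ring)"
  proof (rule injI)
    fix m n :: nat assume "of_nat m = (of_nat n :: 'a int_ring)"
    then have "of_int_ring (of_nat m :: 'a int_ring) = of_int_ring (of_nat n)" by simp
    then show "m = n" by (simp add: of_int_ring_of_nat)
  qed
qed

lemma of_int_ring_of_int: "of_int_ring (of_int n) = of_int n"
  by (cases n rule: int_diff_cases) (simp add: of_int_ring_simps of_int_ring_of_nat)

lemma of_int_ring_sum: "of_int_ring (\<Sum>i\<in>I. g i) = (\<Sum>i\<in>I. of_int_ring (g i))"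
  by (induction I rule: infinite_finite_induct) (simp_all add: of_int_ring_simps)

lemma of_int_ring_poly:
  "of_int_ring (poly (map_poly of_int p) x) = poly (map_poly of_int p) (of_int_ring x)"
  by (induction p) (simp_all add: of_int_ring_simps of_int_ring_of_int map_poly_pCons)

text \<open>Take an integer polynomial with root \<open>x\<close> and remove factors of the variable
  until the constant term is nonzero; the equation then exhibits that constant as a multiple of
  \<open>x\<close>. This reduces questions about divisors of \<open>x\<close> to rational
  integers.\<close>

lemma int_ring_dvd_of_int:
  fixes x :: "'k :: field_char_0 int_ring"
  assumes "x \<noteq> 0"
  obtains N :: int where "N \<noteq> 0" "x dvd of_int N"
proof -
  have *: "\<exists>N::int. N \<noteq> 0 \<and> x dvd of_int N"
    if "p \<noteq> 0" "poly (map_poly of_int p) x = 0" for p :: "int poly"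
    using that
  proof (induction p)
    case (pCons a p)
    have eq: "of_int a + x * poly (map_poly of_int p) x = 0"
      using pCons.prems(2) by (simp add: of_int_hom.map_poly_pCons_hom)
    show ?case
    proof (cases "a = 0")
      case True
      with eq assms pCons show ?thesis by auto
    next
      case False
      have "of_int a = x * (- poly (map_poly of_int p) x)"
        using eq by (simp add: eq_neg_iff_add_eq_0)
      then show ?thesis using False by (intro exI[of _ a]) (auto intro: dvdI)
    qed
  qed simp
  obtain p :: "int poly"
    where p: "poly (map_poly of_int p) (of_int_ring x) = 0" "lead_coeff p = 1"
    using algebraic_int_of_int_ring[of x] by (auto simp: algebraic_int_altdef_ipoly)
  then have "poly (map_poly of_int p) x = 0"
    by (simp add: of_int_ring_inject[symmetric] of_int_ring_poly of_int_ring_simps)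
  moreover have "p \<noteq> 0" using p(2) by auto
  ultimately show thesis using * that by blast
qed

section \<open>Integral linear relations in a number field\<close>

lemma common_denominator:
  assumes "finite S"
  shows "\<exists>D::int. D \<noteq> 0 \<and> (\<forall>y\<in>S. of_int D * (u y :: rat) \<in> \<int>)"
  using assms
proof induction
  case (insert y S)
  then obtain D :: int where D: "D \<noteq> 0" "\<forall>y\<in>S. of_int D * u y \<in> \<int>" by auto
  obtain a b :: int where ab: "u y = of_int a / of_int b" "b \<noteq> 0"
    by (cases "u y") (auto simp: Fract_of_int_quotient)
  have "of_int (b * D) * u z \<in> \<int>" if "z \<in> insert y S" for z
  proof (cases "z = y")
    case True
    then have "of_int (b * D) * u z = of_int (D * a)" using ab by simp
    then show ?thesis by (metis Ints_of_int)
  next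
    case False
    then have "of_int D * u z \<in> \<int>" using D that by auto
    then have "of_int b * (of_int D * u z) \<in> \<int>" by (rule Ints_mult[OF Ints_of_int])
    then show ?thesis by (simp only: of_int_mult mult.assoc)
  qed
  then show ?case using D ab by (intro exI[of _ "b * D"]) auto
qed (auto intro: exI[of _ 1])

text \<open>A finite spanning set \<open>B\<close> bounds the size of rationally independent sets,
  so \<open>m = card B\<close> works; a common denominator then makes the rational coefficients
  integral.\<close>

lemma number_field_integer_relation:
  obtains m :: nat where
    "\<And>S :: 'k :: number_field set. finite S \<Longrightarrow> card S > m \<Longrightarrow>
       \<exists>a :: 'k \<Rightarrow> int. (\<exists>y\<in>S. a y \<noteq> 0) \<and> (\<Sum>y\<in>S. of_int (a y) * y) = 0"
proof -
  obtain B :: "'k set"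
    where B: "finite B" "\<And>x. \<exists>c :: 'k \<Rightarrow> rat. x = (\<Sum>b\<in>B. of_rat (c b) * b)"
    using finite_over_rat by blast
  interpret Q: vector_space "\<lambda>(c::rat) (x::'k). of_rat c * x"
    by standard (simp_all add: algebra_simps of_rat_add of_rat_mult)
  have span: "x \<in> Q.span B" for x
  proof -
    obtain c :: "'k \<Rightarrow> rat" where "x = (\<Sum>b\<in>B. of_rat (c b) * b)" using B(2) by blast
    then show ?thesis by (simp only:) (intro Q.span_sum Q.span_scale Q.span_base)
  qed
  have "\<exists>a :: 'k \<Rightarrow> int. (\<exists>y\<in>S. a y \<noteq> 0) \<and> (\<Sum>y\<in>S. of_int (a y) * y) = 0"
    if S: "finite S" "card S > card B" for S :: "'k set"
  proof -
    have "Q.dependent S"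
      using Q.independent_span_bound[of B S] B(1) S span by fastforce
    then obtain u where u: "\<exists>y\<in>S. u y \<noteq> 0" "(\<Sum>y\<in>S. of_rat (u y) * y) = 0"
      using Q.dependent_finite[OF S(1)] by auto
    obtain D :: int where D: "D \<noteq> 0" "\<forall>y\<in>S. of_int D * u y \<in> \<int>"
      using common_denominator[OF S(1)] by blast
    have "\<forall>y. \<exists>k::int. y \<in> S \<longrightarrow> of_int D * u y = of_int k"
      using D(2) by (auto elim: Ints_cases)
    then obtain a :: "'k \<Rightarrow> int" where a: "\<And>y. y \<in> S \<Longrightarrow> of_int D * u y = of_int (a y)"
      by metis
    have a': "of_int (a y) = (of_int D * of_rat (u y) :: 'k)" if "y \<in> S" for y
      using arg_cong[OF a[OF that], of "of_rat :: rat \<Rightarrow> 'k"] by (simp add: of_rat_mult)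
    have "(\<Sum>y\<in>S. of_int (a y) * y) = of_int D * (\<Sum>y\<in>S. of_rat (u y) * y)"
      unfolding sum_distrib_left by (intro sum.cong) (simp_all add: a' mult.assoc)
    moreover obtain z where z: "z \<in> S" "u z \<noteq> 0" using u(1) by blast
    have "a z \<noteq> 0" using a[OF z(1)] z(2) D(1) by auto
    then have "\<exists>y\<in>S. a y \<noteq> 0" using z(1) by blast
    ultimately show ?thesis using u(2) by auto
  qed
  then show thesis using that by blast
qed

text \<open>Divide by the gcd \<open>g\<close> of the coefficients on \<open>T\<close>. A factor
  \<open>l\<close> common to all quotients would give \<open>g * l dvd g\<close>, impossible for a
  nonunit \<open>l\<close>.\<close>

lemma primitive_integer_relation:
  fixes a :: "'a \<Rightarrow> int" and y :: "'a \<Rightarrow> 'b :: {idom, ring_char_0}"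
  assumes "\<exists>i\<in>T. a i \<noteq> 0" "(\<Sum>i\<in>T. of_int (a i) * y i) = 0" "\<not> l dvd 1"
  obtains b :: "'a \<Rightarrow> int" and i where "i \<in> T" "\<not> l dvd b i" "(\<Sum>i\<in>T. of_int (b i) * y i) = 0"
proof -
  define g where "g = Gcd (a ` T)"
  have g: "g \<noteq> 0" using assms(1) by (auto simp: g_def)
  define b where "b i = a i div g" for i
  have a: "a i = g * b i" if "i \<in> T" for i
    using that by (simp add: b_def g_def)
  have "of_int g * (\<Sum>i\<in>T. of_int (b i) * y i) = (\<Sum>i\<in>T. of_int (a i) * y i)"
    unfolding sum_distrib_left by (intro sum.cong) (simp_all add: a mult.assoc)
  then have "(\<Sum>i\<in>T. of_int (b i) * y i) = 0" using assms(2) g by simp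
  moreover have "\<exists>i\<in>T. \<not> l dvd b i"
  proof (rule ccontr)
    assume "\<not> (\<exists>i\<in>T. \<not> l dvd b i)"
    then have "g * l dvd a i" if "i \<in> T" for i using that a by auto
    then have "g * l dvd Gcd (a ` T)" by (intro Gcd_greatest) auto
    then have "g * l dvd g * 1" by (simp only: g_def[symmetric] mult_1_right)
    then show False using g assms(3) by (simp only: dvd_mult_cancel_left) auto
  qed
  ultimately show thesis using that by blast
qed

section \<open>Prime elements, and finiteness of the set of prime divisors up to associates\<close>

text \<open>With \<open>p' = p * c\<close>, primality of \<open>p'\<close> leaves
  \<open>p' dvd p\<close> or \<open>p' dvd c\<close>, and the latter would make \<open>p\<close> a
  unit. So one-sided divisibility between primes already makes them associated.\<close>

lemma prime_elem_dvd_imp_dvd: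
  fixes p p' :: "'a :: idom"
  assumes "prime_elem p" "prime_elem p'" "p dvd p'"
  shows "p' dvd p"
proof -
  obtain c where c: "p' = p * c" using assms(3) by blast
  have "\<not> p' dvd c"
  proof
    assume "p' dvd c"
    then obtain e where "c = p' * e" by blast
    then have "p' * 1 = p' * (p * e)" using c by (metis mult.left_commute mult_1_right)
    moreover have "p' \<noteq> 0" using assms(2) by auto
    ultimately have "1 = p * e" by (simp only: mult_cancel_left simp_thms)
    then have "p dvd 1" by (rule dvdI)
    then show False using prime_elem_not_unit[OF assms(1)] by blast
  qed
  moreover have "p' dvd p * c" using c by simp
  ultimately show ?thesis using assms(2) prime_elem_dvd_multD by blast
qed

lemma prime_elem_dvd_prod_mset:
  fixes p :: "'a :: comm_semiring_1"
  assumes "prime_elem p" "p dvd prod_mset A"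
  shows "\<exists>a\<in>#A. p dvd a"
  using assms(2)
proof (induction A)
  case empty
  then show ?case using assms(1) prime_elem_not_unit by auto
next
  case (add a A)
  then have "p dvd a \<or> p dvd prod_mset A"
    using prime_elem_dvd_multD[OF assms(1)] by simp
  then show ?case using add.IH by auto
qed

text \<open>If \<open>y\<^sub>p\<close> is the product of the primes other than \<open>p\<close>, an integral relation between the
  \<open>y\<^sub>p\<close> has all its coefficients divisible by \<open>l\<close>. So the \<open>y\<^sub>p\<close> are linearly independent over the
  rationals, and the degree of the field bounds their number.\<close>

lemma finite_primes_dvd_prime_int:
  fixes P :: "'k :: number_field int_ring set" and l :: int
  assumes l: "prime l"
    and P: "\<And>p. p \<in> P \<Longrightarrow> prime_elem p \<and> p dvd of_int l"
    and nonassoc: "\<And>p p'. p \<in> P \<Longrightarrow> p' \<in> P \<Longrightarrow> p dvd p' \<Longrightarrow> p = p'"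
  shows "finite P"
proof (rule ccontr)
  assume "infinite P"
  obtain m :: nat where m: "\<And>S :: 'k set. finite S \<Longrightarrow> card S > m \<Longrightarrow>
       \<exists>a :: 'k \<Rightarrow> int. (\<exists>y\<in>S. a y \<noteq> 0) \<and> (\<Sum>y\<in>S. of_int (a y) * y) = 0"
    using number_field_integer_relation by blast
  obtain T where T: "T \<subseteq> P" "finite T" "card T = Suc m"
    using infinite_arbitrarily_large[OF \<open>infinite P\<close>, of "Suc m"] by auto
  define y where "y p = \<Prod>(T - {p})" for p
  have ndvd: "\<not> p dvd y p" if p: "p \<in> T" for p
  proof
    assume "p dvd y p"
    then have "p dvd prod_mset (mset_set (T - {p}))"
      by (simp add: y_def prod_unfold_prod_mset)
    then obtain p' where "p' \<in># mset_set (T - {p})" "p dvd p'"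
      using prime_elem_dvd_prod_mset P[of p] p T(1) by blast
    then have "p' \<in> T - {p}" "p dvd p'" using T(2) by auto
    then show False using nonassoc p T(1) by blast
  qed
  have dvd: "p dvd y p'" if "p \<in> T" "p' \<in> T" "p \<noteq> p'" for p p'
    unfolding y_def using that T(2) by (intro dvd_prodI) auto
  \<comment> \<open>The bound \<open>m\<close> concerns sets of field elements, so the values must
    be distinct: for \<open>p \<noteq> p'\<close>, the prime \<open>p\<close> divides
    \<open>y p'\<close> but not \<open>y p\<close>.\<close>
  have inj: "inj_on (\<lambda>p. of_int_ring (y p)) T"
  proof (rule inj_onI)
    fix p p' assume "p \<in> T" "p' \<in> T" "of_int_ring (y p) = of_int_ring (y p')"
    then show "p = p'" using ndvd dvd by (metis of_int_ring_inject)
  qed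
  have "card ((\<lambda>p. of_int_ring (y p)) ` T) > m" using card_image[OF inj] T(3) by simp
  from m[OF _ this] T(2) obtain a' :: "'k \<Rightarrow> int" where
    a': "\<exists>p\<in>T. a' (of_int_ring (y p)) \<noteq> 0"
      "(\<Sum>z\<in>(\<lambda>p. of_int_ring (y p)) ` T. of_int (a' z) * z) = 0"
    by auto
  define a where "a p = a' (of_int_ring (y p))" for p
  have "of_int_ring (\<Sum>p\<in>T. of_int (a p) * y p) = of_int_ring 0"
    using a'(2) unfolding sum.reindex[OF inj]
    by (simp add: of_int_ring_sum of_int_ring_simps of_int_ring_of_int a_def)
  then have rel: "(\<Sum>p\<in>T. of_int (a p) * y p) = 0"
    by (simp add: of_int_ring_inject)
  have nontriv: "\<exists>p\<in>T. a p \<noteq> 0" using a'(1) by (simp add: a_def)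
  have "\<not> l dvd 1" using l by (auto simp: not_prime_unit)
  from primitive_integer_relation[OF nontriv rel this] obtain b p where
    b: "p \<in> T" "\<not> l dvd b p" "(\<Sum>p\<in>T. of_int (b p) * y p) = 0" .
  \<comment> \<open>Modulo \<open>p\<close> all other terms of the relation vanish, so
    \<open>p\<close> divides \<open>b p * y p\<close> and hence \<open>b p\<close>. It also divides
    \<open>l\<close>, which is coprime to \<open>b p\<close>, so the Bezout identity makes
    \<open>p\<close> a unit.\<close>
  have "of_int (b p) * y p = - (\<Sum>p'\<in>T - {p}. of_int (b p') * y p')"
    using b T(2) by (simp add: sum.remove[of T p] eq_neg_iff_add_eq_0)
  moreover have "p dvd (\<Sum>p'\<in>T - {p}. of_int (b p') * y p')"
    using b(1) by (intro dvd_sum dvd_mult dvd) auto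
  ultimately have "p dvd of_int (b p) * y p" by simp
  then have pb: "p dvd of_int (b p)"
    using ndvd[OF b(1)] P b(1) T(1) prime_elem_dvd_multD[of p] by blast
  have "coprime l (b p)" using l b(2) by (simp add: prime_imp_coprime)
  then obtain s t where st: "s * l + t * b p = 1"
    using bezout_int[of l "b p"] by auto
  have "of_int s * of_int l + of_int t * of_int (b p) = (1 :: 'k int_ring)"
    unfolding of_int_mult[symmetric] of_int_add[symmetric] st by simp
  moreover have "p dvd of_int s * of_int l + of_int t * of_int (b p)"
    using pb P[of p] b(1) T(1) by (intro dvd_add dvd_mult) auto
  ultimately have "p dvd 1" by simp
  then show False using P[of p] b(1) T(1) prime_elem_not_unit[of p] by blast
qed

text \<open>Since \<open>x\<close> divides a nonzero integer \<open>N\<close>, each member of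
  \<open>P\<close> divides one of the finitely many rational prime factors of \<open>N\<close>, and
  each such factor accounts for only finitely many members.\<close>

lemma finite_primes_dvd:
  fixes P :: "'k :: number_field int_ring set"
  assumes "x \<noteq> 0"
    and P: "\<And>p. p \<in> P \<Longrightarrow> prime_elem p \<and> p dvd x"
    and nonassoc: "\<And>p p'. p \<in> P \<Longrightarrow> p' \<in> P \<Longrightarrow> p dvd p' \<Longrightarrow> p = p'"
  shows "finite P"
proof -
  obtain N :: int where N: "N \<noteq> 0" "x dvd of_int N"
    using int_ring_dvd_of_int[OF assms(1)] by blast
  have "\<exists>l\<in>prime_factors N. p dvd of_int l" if p: "p \<in> P" for p
  proof -
    \<comment> \<open>\<open>N\<close> equals the product of its prime factors only up to sign,
      hence the detour through \<open>normalize\<close>.\<close>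
    have "N dvd normalize (prod_mset (prime_factorization N))"
      unfolding prod_mset_prime_factorization_weak[OF N(1)] by simp
    then have "N dvd prod_mset (prime_factorization N)" by (simp only: dvd_normalize_iff)
    then have "of_int N dvd (of_int (prod_mset (prime_factorization N)) :: 'k int_ring)"
      by (rule of_int_hom.hom_dvd)
    then have "x dvd of_int (prod_mset (prime_factorization N))" by (rule dvd_trans[OF N(2)])
    then have "p dvd of_int (prod_mset (prime_factorization N))"
      using P[OF p] dvd_trans by blast
    then have "p dvd prod_mset (image_mset of_int (prime_factorization N))"
      by (simp only: of_int_hom.hom_prod_mset)
    then obtain z where "z \<in># image_mset of_int (prime_factorization N)" "p dvd z"
      using prime_elem_dvd_prod_mset P[OF p] by blast
    then show ?thesis by auto
  qed
  then have "P \<subseteq> (\<Union>l\<in>prime_factors N. {p\<in>P. p dvd of_int l})" by blast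
  moreover have "finite {p\<in>P. p dvd of_int l}" if "l \<in> prime_factors N" for l
  proof (rule finite_primes_dvd_prime_int)
    show "prime l" using that by blast
  qed (use P nonassoc in auto)
  ultimately show ?thesis by (meson finite_UN_I finite_set_mset finite_subset)
qed

section \<open>Evaluation of polynomials and coefficients of binary forms\<close>

lemma lookup_map:
  "h 0 = 0 \<Longrightarrow> Poly_Mapping.lookup (Poly_Mapping.map h p) m = h (Poly_Mapping.lookup p m)"
  by (simp add: Poly_Mapping.map.rep_eq when_def)

lemma keys_map_inj:
  assumes "h 0 = 0" "inj h"
  shows "Poly_Mapping.keys (Poly_Mapping.map h p) = Poly_Mapping.keys p"
  using assms by (auto simp: in_keys_iff lookup_map) (metis injD)

lemma eval_mpoly_superset:
  assumes "h 0 = 0" "finite S" "Poly_Mapping.keys p \<subseteq> S"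
  shows "eval_mpoly h s p = (\<Sum>m\<in>S. h (Poly_Mapping.lookup p m) *
    (\<Prod>i\<in>Poly_Mapping.keys m. s i ^ Poly_Mapping.lookup m i))"
  unfolding eval_mpoly_def using assms
  by (intro sum.mono_neutral_left) (auto simp: in_keys_iff)

lemma eval_mpoly_hom:
  assumes "\<phi> 0 = 0" "\<phi> 1 = 1"
    and "\<And>x y. \<phi> (x + y) = \<phi> x + \<phi> y" "\<And>x y. \<phi> (x * y) = \<phi> x * \<phi> y"
    and "\<And>k. \<phi> (h k) = h' k"
  shows "eval_mpoly h' (\<lambda>i. \<phi> (s i)) p = \<phi> (eval_mpoly h s p)"
proof -
  have sum: "\<phi> (\<Sum>i\<in>S. g i) = (\<Sum>i\<in>S. \<phi> (g i))" for S :: "(nat \<Rightarrow>\<^sub>0 nat) set" and g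
    by (induction S rule: infinite_finite_induct) (simp_all add: assms)
  have prod: "\<phi> (\<Prod>i\<in>S. g i) = (\<Prod>i\<in>S. \<phi> (g i))" for S :: "nat set" and g
    by (induction S rule: infinite_finite_induct) (simp_all add: assms)
  have pow: "\<phi> (y ^ k) = \<phi> y ^ k" for y k
    by (induction k) (simp_all add: assms)
  show ?thesis by (simp add: eval_mpoly_def sum prod pow assms)
qed

lemma eval_mpoly_homogeneous:
  assumes "homogeneous q p"
  shows "eval_mpoly h (\<lambda>i. c * s i) p = c ^ q * eval_mpoly h s p"
proof -
  have "(\<Prod>i\<in>Poly_Mapping.keys m. (c * s i) ^ Poly_Mapping.lookup m i) =
      c ^ q * (\<Prod>i\<in>Poly_Mapping.keys m. s i ^ Poly_Mapping.lookup m i)"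
    if "m \<in> Poly_Mapping.keys p" for m
    using assms that by (simp add: homogeneous_def power_mult_distrib prod.distrib flip: power_sum)
  then show ?thesis
    by (simp add: eval_mpoly_def sum_distrib_left mult_ac)
qed

lemma Const_0: "Const 0 = 0"
  by (simp add: Const_def)

lemma Const_mult: "Const (a * b) = Const a * Const b"
  by (simp add: Const_def mult_single)

lemma Const_power: "Const (a ^ k) = Const a ^ k"
  by (induction k) (simp_all add: Const_mult, simp add: Const_def)

lemma Var_power: "Var i ^ k = Poly_Mapping.single (Poly_Mapping.single i k) 1"
  by (induction k) (simp_all add: Var_def mult_single flip: single_add)

lemma form_monomial:
  "Const c * Var 0 ^ i * Var 1 ^ k =
     Poly_Mapping.single (Poly_Mapping.single 0 i + Poly_Mapping.single 1 k) c"
  by (simp add: Const_def Var_power mult_single)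

lemma lookup_form_exponent:
  "Poly_Mapping.lookup (Poly_Mapping.single (0::nat) i + Poly_Mapping.single 1 k) m =
     (if m = 0 then i else if m = 1 then k else (0::nat))"
  by (simp add: lookup_add lookup_single when_def)

lemma form_exponent_inj:
  "Poly_Mapping.single (0::nat) i + Poly_Mapping.single 1 k =
     Poly_Mapping.single 0 i' + Poly_Mapping.single 1 (k'::nat) \<longleftrightarrow> i = i' \<and> k = k'"
  by (metis lookup_form_exponent zero_neq_one)

text \<open>For \<open>k > d\<close> the truncated difference \<open>d - k\<close> is 0, so the
  coefficient is looked up at the pure power of \<open>Var 0\<close> with exponent \<open>k\<close>,
  which no form of degree \<open>d\<close> contains.\<close>

lemma form_coeff_form:
  "form_coeff d (\<Sum>i\<le>d. Const (a i) * Var 0 ^ i * Var 1 ^ (d - i)) k = (if k \<le> d then a k else 0)"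
proof -
  have "form_coeff d (\<Sum>i\<le>d. Const (a i) * Var 0 ^ i * Var 1 ^ (d - i)) k =
      (\<Sum>i\<le>d. if i = k then a i else 0)"
    unfolding form_coeff_def form_monomial lookup_sum lookup_single form_exponent_inj
    by (intro sum.cong) (auto simp: when_def)
  then show ?thesis by simp
qed

lemma binary_form_eq:
  assumes "is_binary_form d f"
  shows "f = (\<Sum>i\<le>d. Const (form_coeff d f i) * Var 0 ^ i * Var 1 ^ (d - i))"
proof -
  obtain a where a: "f = (\<Sum>i\<le>d. Const (a i) * Var 0 ^ i * Var 1 ^ (d - i))"
    using assms by (auto simp: is_binary_form_def)
  then have "form_coeff d f i = a i" if "i \<le> d" for i
    using that by (simp only: a form_coeff_form if_True)
  then show ?thesis by (subst a) (intro sum.cong, auto)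
qed

lemma form_coeff_map:
  "h 0 = 0 \<Longrightarrow> form_coeff d (Poly_Mapping.map h f) i = h (form_coeff d f i)"
  by (simp add: form_coeff_def lookup_map)

text \<open>Describing all coefficients at once lets \<open>is_binary_form_map\<close> compare two
  forms monomial by monomial.\<close>

lemma lookup_form:
  "Poly_Mapping.lookup (\<Sum>i\<le>d. Const (c i) * Var 0 ^ i * Var 1 ^ (d - i)) m =
     (if \<exists>i\<le>d. m = Poly_Mapping.single 0 i + Poly_Mapping.single 1 (d - i)
      then c (Poly_Mapping.lookup m 0) else 0)"
proof (cases "\<exists>i\<le>d. m = Poly_Mapping.single 0 i + Poly_Mapping.single 1 (d - i)")
  case True
  then obtain i where i: "i \<le> d" "m = Poly_Mapping.single 0 i + Poly_Mapping.single 1 (d - i)"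
    by blast
  have "Poly_Mapping.lookup m 0 = i" unfolding i(2) lookup_form_exponent by simp
  then show ?thesis
    using i form_coeff_form[of d c i] unfolding form_coeff_def by auto
next
  case False
  then show ?thesis
    unfolding form_monomial lookup_sum lookup_single
    by (auto simp: when_def intro!: sum.neutral)
qed

lemma lookup_binary_form:
  assumes "is_binary_form d f"
  shows "Poly_Mapping.lookup f m =
     (if \<exists>i\<le>d. m = Poly_Mapping.single 0 i + Poly_Mapping.single 1 (d - i)
      then form_coeff d f (Poly_Mapping.lookup m 0) else 0)"
  by (subst binary_form_eq[OF assms]) (rule lookup_form)

lemma is_binary_form_map:
  assumes f: "is_binary_form d f" and h: "h 0 = 0"
  shows "is_binary_form d (Poly_Mapping.map h f)"
proof -
  have "Poly_Mapping.map h f =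
      (\<Sum>i\<le>d. Const (h (form_coeff d f i)) * Var 0 ^ i * Var 1 ^ (d - i))"
    by (rule poly_mapping_eqI)
       (simp only: lookup_map[of h, OF h] lookup_form lookup_binary_form[OF f] if_distrib[of h] h)
  then show ?thesis unfolding is_binary_form_def
    by (intro exI[of _ "\<lambda>i. h (form_coeff d f i)"])
qed

lemma eval_binary_form:
  assumes f: "is_binary_form d f" and h: "h 0 = 0"
  shows "eval_mpoly h s f = (\<Sum>i\<le>d. h (form_coeff d f i) * s 0 ^ i * s 1 ^ (d - i))"
proof -
  define e :: "nat \<Rightarrow> nat \<Rightarrow>\<^sub>0 nat"
    where "e i = Poly_Mapping.single 0 i + Poly_Mapping.single 1 (d - i)" for i
  have inj: "inj_on e {..d}"
    by (rule inj_onI) (simp only: e_def form_exponent_inj)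
  \<comment> \<open>Monomials with coefficient 0 are missing from \<open>keys f\<close>, so only an
    inclusion holds; the added terms are zero.\<close>
  have "Poly_Mapping.keys f \<subseteq> e ` {..d}"
    by (auto simp: in_keys_iff lookup_binary_form[OF f] e_def split: if_splits)
  then have "eval_mpoly h s f = (\<Sum>m\<in>e ` {..d}. h (Poly_Mapping.lookup f m) *
    (\<Prod>i\<in>Poly_Mapping.keys m. s i ^ Poly_Mapping.lookup m i))"
    using h by (intro eval_mpoly_superset) auto
  also have "\<dots> = (\<Sum>i\<le>d. h (Poly_Mapping.lookup f (e i)) *
    (\<Prod>k\<in>Poly_Mapping.keys (e i). s k ^ Poly_Mapping.lookup (e i) k))"
    by (simp add: sum.reindex[OF inj])
  also have "\<dots> = (\<Sum>i\<le>d. h (form_coeff d f i) * s 0 ^ i * s 1 ^ (d - i))"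
  proof (intro sum.cong refl)
    fix i
    \<comment> \<open>A variable with exponent 0 is missing from \<open>keys (e i)\<close>; its
      factor is a zeroth power, that is 1.\<close>
    have "(\<Prod>k\<in>Poly_Mapping.keys (e i). s k ^ Poly_Mapping.lookup (e i) k) =
        (\<Prod>k\<in>{0, 1}. s k ^ Poly_Mapping.lookup (e i) k)"
      unfolding e_def
      by (intro prod.mono_neutral_left)
         (auto simp: in_keys_iff lookup_form_exponent[unfolded One_nat_def] split: if_splits)
    also have "\<dots> = s 0 ^ i * s 1 ^ (d - i)"
      by (simp add: e_def lookup_form_exponent[unfolded One_nat_def])
    finally show "h (Poly_Mapping.lookup f (e i)) *
      (\<Prod>k\<in>Poly_Mapping.keys (e i). s k ^ Poly_Mapping.lookup (e i) k) =
      h (form_coeff d f i) * s 0 ^ i * s 1 ^ (d - i)"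
      by (simp add: form_coeff_def e_def mult.assoc)
  qed
  finally show ?thesis .
qed

lemma form_coeff_form_subst_diag:
  assumes "is_binary_form d f"
  shows "form_coeff d (form_subst (mat_of_rows_list 2 [[a, 0], [0, b]]) f) i =
    (if i \<le> d then form_coeff d f i * a ^ i * b ^ (d - i) else 0)"
proof -
  have "form_subst (mat_of_rows_list 2 [[a, 0], [0, b]]) f =
      (\<Sum>i\<le>d. Const (form_coeff d f i * a ^ i * b ^ (d - i)) * Var 0 ^ i * Var 1 ^ (d - i))"
    unfolding form_subst_def eval_binary_form[OF assms, of Const, OF Const_0]
    by (intro sum.cong refl)
       (simp add: mat_of_rows_list_def Const_0 Const_mult Const_power power_mult_distrib mult_ac)
  then show ?thesis by (simp only: form_coeff_form)
qed

section \<open>Invariants under diagonal substitution, and degrees of generators\<close>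

text \<open>In characteristic 0 no nonzero integer coefficient maps to 0, so both evaluations sum
  over the same monomials. This links \<open>inv_value\<close> to the invariance condition in
  \<open>sl2_invariants\<close>.\<close>

lemma inv_value_eq_eval_map:
  fixes g :: "'a :: {comm_ring_1, ring_char_0} mpoly"
  shows "inv_value d I g = eval_mpoly id (form_coeff d g) (Poly_Mapping.map of_int I)"
  by (simp add: inv_value_def eval_mpoly_def lookup_map keys_map_inj[of of_int] inj_def)

text \<open>The scalar \<open>1 / \<mu>\<close> multiplies every coefficient of a form of degree
  \<open>d\<close> by \<open>(1 / \<mu>) ^ d\<close>, and homogeneity raises this factor to the
  power \<open>q\<close>. Writing the entry with \<open>\<mu> ^ 2\<close> keeps square roots out of
  the statement.\<close>

lemma inv_value_form_subst_diag:
  fixes g :: "'a :: field_char_0 mpoly"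
  assumes inv: "(Poly_Mapping.map of_int I :: 'a mpoly) \<in> sl2_invariants d"
    and hom: "homogeneous q (Poly_Mapping.map of_int I :: 'a mpoly)"
    and g: "is_binary_form d g"
    and "\<mu> \<noteq> 0"
  shows "inv_value d I (form_subst (mat_of_rows_list 2 [[1 / \<mu> ^ 2, 0], [0, 1]]) g) =
    (1 / \<mu>) ^ (d * q) * inv_value d I g"
proof -
  define N where "N = mat_of_rows_list 2 [[1 / \<mu>, 0], [0, \<mu>]]"
  have N: "N \<in> carrier_mat 2 2" by (simp add: N_def mat_of_rows_list_def numeral_2_eq_2)
  have "upper_triangular N" by (auto simp: N_def mat_of_rows_list_def less_Suc_eq)
  then have "det N = 1"
    using \<open>\<mu> \<noteq> 0\<close> N
    by (simp add: det_upper_triangular diag_mat_def)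
       (simp add: N_def mat_of_rows_list_def numeral_2_eq_2)
  then have "N \<in> SL2" using N by (simp add: SL2_def)
  then have eq: "inv_value d I (form_subst N g) = inv_value d I g"
    using inv g by (simp add: sl2_invariants_def inv_value_eq_eval_map)
  \<comment> \<open>The matrix is \<open>1 / \<mu>\<close> times \<open>N\<close>; for
    \<open>i \<le> d\<close> both sides scale the coefficient by
    \<open>(1 / \<mu>) ^ (2 * i)\<close>, and beyond \<open>d\<close> both are 0.\<close>
  have "form_coeff d (form_subst (mat_of_rows_list 2 [[1 / \<mu> ^ 2, 0], [0, 1]]) g) i =
      (1 / \<mu>) ^ d * form_coeff d (form_subst N g) i" for i
  proof (cases "i \<le> d")
    case True
    then have "(1 / \<mu>) ^ d * \<mu> ^ (d - i) = (1 / \<mu>) ^ i"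
      using \<open>\<mu> \<noteq> 0\<close> by (simp add: power_diff power_divide)
    then have "(1 / \<mu> ^ 2) ^ i = (1 / \<mu>) ^ d * ((1 / \<mu>) ^ i * \<mu> ^ (d - i))"
      by (simp add: power_divide power2_eq_square power_mult_distrib)
    with True show ?thesis
      by (simp add: N_def form_coeff_form_subst_diag[OF g] mult_ac)
  next
    case False
    then show ?thesis by (simp add: N_def form_coeff_form_subst_diag[OF g])
  qed
  then have "form_coeff d (form_subst (mat_of_rows_list 2 [[1 / \<mu> ^ 2, 0], [0, 1]]) g) =
      (\<lambda>i. (1 / \<mu>) ^ d * form_coeff d (form_subst N g) i)" by (rule ext)
  then show ?thesis
    unfolding eq[symmetric]
    by (simp add: inv_value_eq_eval_map eval_mpoly_homogeneous[OF hom] power_mult)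
qed

text \<open>A generator of degree 0 is a constant, and constants lie in every generated subalgebra,
  so omitting it would contradict minimality. The exponents \<open>r p\<close> are thereby quotients
  with nonzero denominator.\<close>

lemma minimal_homogeneous_generators_degree_pos:
  assumes gen: "minimal_homogeneous_generators d n q I" and k: "k \<le> n"
  shows "q k > 0"
proof (rule ccontr)
  assume "\<not> q k > 0"
  then have "homogeneous 0 (I k)"
    using gen k by (auto simp: minimal_homogeneous_generators_def)
  then have "Poly_Mapping.keys (I k) \<subseteq> {0}"
    by (force simp: homogeneous_def intro: poly_mapping_eqI simp: in_keys_iff)
  then have "I k = Const (Poly_Mapping.lookup (I k) 0)"
    by (intro poly_mapping_eqI) (auto simp: Const_def lookup_single when_def in_keys_iff)
  then have Ik: "I k \<in> subalgebra_generated (I ` ({..n} - {k}))"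
    by (metis gen_const)
  have "subalgebra_generated (I ` {..n}) \<subseteq> subalgebra_generated (I ` ({..n} - {k}))"
  proof
    fix p assume "p \<in> subalgebra_generated (I ` {..n})"
    then show "p \<in> subalgebra_generated (I ` ({..n} - {k}))"
    proof induction
      case (gen_base p)
      then obtain i where "i \<le> n" "p = I i" by auto
      then show ?case using Ik by (cases "i = k") (auto intro: subalgebra_generated.gen_base)
    qed (auto intro: subalgebra_generated.intros)
  qed
  moreover have "subalgebra_generated (I ` ({..n} - {k})) \<subseteq> subalgebra_generated (I ` {..n})"
  proof
    fix p assume "p \<in> subalgebra_generated (I ` ({..n} - {k}))"
    then show "p \<in> subalgebra_generated (I ` {..n})"
      by induction (auto intro: subalgebra_generated.intros)
  qed
  ultimately show False using gen k by (auto simp: minimal_homogeneous_generators_def)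
qed

section \<open>Valuations as logarithms on nonzero elements\<close>

lemma valuation_finite:
  assumes "is_valuation w" "x \<noteq> 0"
  shows "\<bar>w x\<bar> \<noteq> \<infinity>"
  using assms(1)[unfolded is_valuation_def, THEN conjunct2, THEN conjunct1] assms(2)
  by (simp only: simp_thms)

lemma valuation_eq_ereal:
  assumes "is_valuation w" "x \<noteq> 0"
  shows "w x = ereal (real_of_ereal (w x))"
  by (rule ereal_real'[OF valuation_finite[OF assms], symmetric])

text \<open>Values at nonzero elements are finite, so they can be handled as reals, where
  cancellation and division are available.\<close>

lemma real_valuation_mult:
  assumes w: "is_valuation w" and "x \<noteq> 0" "y \<noteq> 0"
  shows "real_of_ereal (w (x * y)) = real_of_ereal (w x) + real_of_ereal (w y)"
proof -
  have "w (x * y) = w x + w y"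
    using w[unfolded is_valuation_def, THEN conjunct2, THEN conjunct2, THEN conjunct1]
    by (simp only: simp_thms)
  then show ?thesis
    by (simp add: valuation_finite[OF w] assms real_of_ereal_add)
qed

context
  fixes u :: "'a :: field \<Rightarrow> real"
  assumes u_mult: "\<And>x y. x \<noteq> 0 \<Longrightarrow> y \<noteq> 0 \<Longrightarrow> u (x * y) = u x + u y"
begin

lemma log_hom_1: "u 1 = 0"
  using u_mult[of 1 1] by simp

lemma log_hom_power: "x \<noteq> 0 \<Longrightarrow> u (x ^ k) = k * u x"
  by (induction k) (simp_all add: log_hom_1 u_mult algebra_simps)

lemma log_hom_divide: "x \<noteq> 0 \<Longrightarrow> u (1 / x) = - u x"
  using u_mult[of x "1 / x"] by (simp add: log_hom_1)

lemma log_hom_prod: "(\<And>i. i \<in> S \<Longrightarrow> g i \<noteq> 0) \<Longrightarrow> u (\<Prod>i\<in>S. g i) = (\<Sum>i\<in>S. u (g i))"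
  by (induction S rule: infinite_finite_induct) (simp_all add: log_hom_1 u_mult)

text \<open>For \<open>r = a / b\<close> the equation \<open>z ^ b = x ^ a\<close> gives
  \<open>b * u z = a * u x\<close>. Nonnegativity of \<open>r\<close> turns the integer power in
  \<open>is_rat_power\<close> into a natural one.\<close>

lemma log_hom_rat_power:
  assumes "is_rat_power x r z" "r \<ge> 0" "x \<noteq> 0"
  shows "z \<noteq> 0" "u z = of_rat r * u x"
proof -
  obtain a b where ab: "quotient_of r = (a, b)" by (cases "quotient_of r")
  have b: "b > 0" using quotient_of_denom_pos[OF ab] .
  have r: "r = of_int a / of_int b" using quotient_of_div[OF ab] .
  have "a \<ge> 0" using assms(2) b by (simp add: r zero_le_divide_iff)
  then have eq: "z ^ nat b = x ^ nat a"
    using assms(1) by (simp add: is_rat_power_def ab power_int_def)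
  then show z: "z \<noteq> 0" using assms(3) b by (auto simp: power_0_left)
  have "real (nat b) * u z = real (nat a) * u x"
    using arg_cong[OF eq, of u] z assms(3) by (simp add: log_hom_power)
  then show "u z = of_rat r * u x"
    using b \<open>a \<ge> 0\<close> by (simp add: r of_rat_divide field_simps)
qed

end

section \<open>Passage to the algebraic closure, and exponents of primes\<close>

lemma int_to_ac_hom:
  "int_to_ac 0 = 0" "int_to_ac 1 = 1"
  "int_to_ac (x + y) = int_to_ac x + int_to_ac y" "int_to_ac (x * y) = int_to_ac x * int_to_ac y"
  by (simp_all add: int_to_ac_def of_int_ring_simps)

lemma int_to_ac_of_int: "int_to_ac (of_int k) = of_int k"
  by (simp add: int_to_ac_def of_int_ring_of_int)

lemma int_to_ac_eq_0_iff: "int_to_ac x = 0 \<longleftrightarrow> x = 0"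
  by (simp add: int_to_ac_def of_int_ring_simps flip: of_int_ring_inject)

text \<open>The invariants have integer coefficients, which the ring homomorphism
  \<open>int_to_ac\<close> preserves, so it commutes with evaluation.\<close>

lemma inv_value_int_to_ac:
  "inv_value d I (Poly_Mapping.map int_to_ac f) = int_to_ac (inv_value d I f)"
proof -
  have "form_coeff d (Poly_Mapping.map int_to_ac f) = (\<lambda>i. int_to_ac (form_coeff d f i))"
    by (rule ext) (simp add: form_coeff_map int_to_ac_hom)
  then show ?thesis
    unfolding inv_value_def by (simp add: eval_mpoly_hom int_to_ac_hom int_to_ac_of_int)
qed

lemma p_exponent_0:
  assumes "\<not> p dvd x"
  shows "p_exponent p x = 0"
proof -
  have "k = 0" if "p ^ k dvd x" for k
  proof (rule ccontr)
    assume "k \<noteq> 0"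
    then have "p dvd p ^ k" by simp
    from dvd_trans[OF this that] assms show False by blast
  qed
  then have "p ^ k dvd x \<longleftrightarrow> k = 0" for k by (cases k) (auto simp del: power_Suc)
  then show ?thesis by (simp add: p_exponent_def)
qed

text \<open>If \<open>p ^ 2\<close> divided \<open>p\<close>, cancellation would make
  \<open>p\<close> a unit; so \<open>Max\<close> is taken over the exponents 0 and 1.\<close>

lemma p_exponent_self:
  fixes p :: "'a :: idom"
  assumes "prime_elem p"
  shows "p_exponent p p = 1"
proof -
  have "k \<le> 1" if "p ^ k dvd p" for k
  proof (rule ccontr)
    assume "\<not> k \<le> 1"
    then have "p ^ 2 dvd p ^ k" by (intro le_imp_power_dvd) simp
    from dvd_trans[OF this that] have "p * p dvd p * 1" by (simp add: power2_eq_square)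
    then have "p dvd 1" using assms by (simp only: dvd_mult_cancel_left) auto
    then show False using prime_elem_not_unit[OF assms] by blast
  qed
  moreover have "p ^ k dvd p" if "k \<le> 1" for k
    using le_imp_power_dvd[OF that, of p] by simp
  ultimately have "p ^ k dvd p \<longleftrightarrow> k \<le> 1" for k by (rule iffI)
  then have "{k. p ^ k dvd p} = {..1}" by (simp only: atMost_def)
  then show ?thesis by (simp only: p_exponent_def) (rule Max_eqI, auto)
qed

text \<open>Mutual divisibility passes to powers, so both maxima are over the same set. This moves
  between an arbitrary prime and its representative in \<open>P\<close>.\<close>

lemma p_exponent_cong:
  assumes "p dvd p'" "p' dvd p"
  shows "p_exponent p x = p_exponent p' x"
proof -
  have "p ^ k dvd x \<longleftrightarrow> p' ^ k dvd x" for k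
    by (rule iffI) (rule dvd_trans[OF dvd_power_same], rule assms, assumption)+
  then show ?thesis by (simp add: p_exponent_def)
qed

section \<open>Semistability, one prime at a time\<close>

theorem proposition2:
  fixes f :: "'k :: number_field int_ring mpoly"
    and d n :: nat and q :: "nat \<Rightarrow> nat" and \<xi> :: "nat \<Rightarrow> int mpoly"
    and v :: "'k int_ring \<Rightarrow> 'k alg_closure \<Rightarrow> ereal"
    and x :: "nat \<Rightarrow> 'k int_ring"
    and P :: "'k int_ring set" and \<alpha> j :: "'k int_ring \<Rightarrow> nat"
    and r :: "'k int_ring \<Rightarrow> rat" and \<rho> :: "'k int_ring \<Rightarrow> 'k alg_closure"
    and lam :: "'k alg_closure" and M :: "'k alg_closure mat"
  assumes "minimal_homogeneous_generators d n q
      (\<lambda>i. Poly_Mapping.map of_int (\<xi> i) :: 'k alg_closure mpoly)"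
    and "\<And>p. prime_elem p \<Longrightarrow> extends_p_val p (v p)"
    and "d \<ge> 2"
    and "is_binary_form d f"
    and "\<And>i. x i = inv_value d (\<xi> i) f"
    and "\<exists>i\<le>n. x i \<noteq> 0"
    and "normalized n q x"
    and "\<And>p. p \<in> P \<Longrightarrow> prime_elem p \<and> (\<forall>i\<le>n. p dvd x i)"
    and "\<And>p. prime_elem p \<Longrightarrow> \<forall>i\<le>n. p dvd x i \<Longrightarrow> \<exists>!p'. p' \<in> P \<and> p dvd p' \<and> p' dvd p"
    and "\<And>p. p \<in> P \<Longrightarrow> \<alpha> p = Min {p_exponent p (x i) | i. i \<le> n \<and> x i \<noteq> 0}"
    and "\<And>p. p \<in> P \<Longrightarrow> j p \<le> n \<and> x (j p) \<noteq> 0 \<and> p_exponent p (x (j p)) = \<alpha> p"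
    and "\<And>p. p \<in> P \<Longrightarrow> r p = 2 * of_nat (\<alpha> p) / (of_nat d * of_nat (q (j p)))"
    and "\<And>p. p \<in> P \<Longrightarrow> is_rat_power (int_to_ac p) (r p) (\<rho> p)"
    and "lam = (\<Prod>p\<in>P. \<rho> p)"
    and "M = mat_of_rows_list 2 [[1 / lam, 0], [0, 1]]"
  shows "semistable v d n \<xi> (form_subst M (Poly_Mapping.map int_to_ac f))"
proof -
  note gen = assms(1) and val = assms(2) and f = assms(4) and x = assms(5)
    and P = assms(8) and P_ex1 = assms(9) and j = assms(11) and r = assms(12) and \<rho> = assms(13)
  obtain i0 where i0: "i0 \<le> n" "x i0 \<noteq> 0" using assms(6) by blast
  have q: "q i > 0" if "i \<le> n" for i
    using minimal_homogeneous_generators_degree_pos[OF gen that] .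
  \<comment> \<open>Divisibility between primes is mutual, so \<open>p\<close> and \<open>p'\<close>
    both represent the class of \<open>p\<close>, and uniqueness of the representative identifies
    them.\<close>
  have P_assoc: "p = p'" if "p \<in> P" "p' \<in> P" "p dvd p'" for p p'
  proof -
    have p': "p' dvd p" using prime_elem_dvd_imp_dvd[OF _ _ that(3)] P[OF that(1)] P[OF that(2)] by (simp only: simp_thms)
    have "\<exists>!p''. p'' \<in> P \<and> p dvd p'' \<and> p'' dvd p"
      by (rule P_ex1[OF P[OF that(1), THEN conjunct1] P[OF that(1), THEN conjunct2]])
    then obtain a where a: "\<forall>p''. p'' \<in> P \<and> p dvd p'' \<and> p'' dvd p \<longrightarrow> p'' = a"
      by (elim ex1E) (rule that)
    have "p = a" using a[THEN spec, of p] that(1) by simp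
    moreover have "p' = a" using a[THEN spec, of p'] that p' by simp
    ultimately show ?thesis by simp
  qed
  have fin: "finite P"
  proof (rule finite_primes_dvd)
    show "x i0 \<noteq> 0" by (rule i0)
    show "prime_elem p \<and> p dvd x i0" if "p \<in> P" for p
      using P[OF that] i0(1) by blast
  qed (rule P_assoc)
  have r_nonneg: "r p \<ge> 0" if "p \<in> P" for p
    by (simp add: r[OF that])
  have P_nonzero: "int_to_ac p \<noteq> 0" if "p \<in> P" for p
    using P[OF that] by (auto simp: int_to_ac_eq_0_iff)
  show ?thesis
    unfolding semistable_def
  proof (intro allI impI)
    fix p :: "'k int_ring" assume p: "prime_elem p"
    have val_p: "is_valuation (v p)" "v p (int_to_ac y) = p_val p y" for y
      using val[OF p] by (simp_all add: extends_p_val_def)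
    \<comment> \<open>\<open>real_of_ereal\<close> sends infinity to 0, so \<open>u\<close> carries
      the valuation only at nonzero arguments; hence the nonvanishing facts below.\<close>
    define u where "u y = real_of_ereal (v p y)" for y
    have vu: "v p y = ereal (u y)" if "y \<noteq> 0" for y
      unfolding u_def by (rule valuation_eq_ereal[OF val_p(1) that])
    have u_mult: "u (y * z) = u y + u z" if "y \<noteq> 0" "z \<noteq> 0" for y z
      unfolding u_def by (rule real_valuation_mult[OF val_p(1) that])
    have u_int: "u (int_to_ac y) = p_exponent p y" if "y \<noteq> 0" for y
      using val_p(2)[of y] vu[of "int_to_ac y"] that
      by (simp add: p_val_def int_to_ac_eq_0_iff)
    have \<rho>_nonzero: "\<rho> p' \<noteq> 0" and u_\<rho>: "u (\<rho> p') = of_rat (r p') * p_exponent p p'"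
      if "p' \<in> P" for p'
      using log_hom_rat_power[OF u_mult \<rho>[OF that] r_nonneg[OF that] P_nonzero[OF that]]
        u_int[of p'] P[OF that] by auto
    have lam: "lam \<noteq> 0" using fin \<rho>_nonzero by (simp add: assms(14))
    have u_lam: "u lam = (\<Sum>p'\<in>P. of_rat (r p') * p_exponent p p')"
      using \<rho>_nonzero u_\<rho> by (simp add: assms(14) log_hom_prod[OF u_mult])
    \<comment> \<open>The square root exists because the closure is algebraically closed.\<close>
    obtain \<mu> where \<mu>: "\<mu> ^ 2 = lam"
      using nth_root_exists[of 2 lam] by auto
    then have "\<mu> \<noteq> 0" using lam by auto
    have u_\<mu>: "u \<mu> = u lam / 2"
      using log_hom_power[OF u_mult \<open>\<mu> \<noteq> 0\<close>, of 2] \<mu> by simp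
    have val_M: "v p (inv_value d (\<xi> i) (form_subst M (Poly_Mapping.map int_to_ac f))) =
        ereal (p_exponent p (x i) - real (d * q i) * (u lam / 2))"
      if i: "i \<le> n" "x i \<noteq> 0" for i
    proof -
      let ?I = "\<lambda>i. Poly_Mapping.map of_int (\<xi> i) :: 'k alg_closure mpoly"
      \<comment> \<open>A generator is itself invariant, since it lies in the algebra that it
        generates with the others.\<close>
      have "?I i \<in> subalgebra_generated (?I ` {..n})"
        using i(1) by (intro gen_base imageI) simp
      also have "\<dots> = sl2_invariants d"
        using gen by (simp only: minimal_homogeneous_generators_def)
      finally have inv: "?I i \<in> sl2_invariants d" .
      have hom: "homogeneous (q i) (?I i)"
        using gen i(1) by (simp add: minimal_homogeneous_generators_def)
      have eq: "inv_value d (\<xi> i) (form_subst M (Poly_Mapping.map int_to_ac f)) =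
          (1 / \<mu>) ^ (d * q i) * int_to_ac (x i)"
        unfolding assms(15) \<mu>[symmetric] x inv_value_int_to_ac[symmetric]
        using inv_value_form_subst_diag[OF inv hom _ \<open>\<mu> \<noteq> 0\<close>]
          is_binary_form_map[of d f int_to_ac, OF f int_to_ac_hom(1)] by simp
      have X: "int_to_ac (x i) \<noteq> 0" using i(2) by (simp add: int_to_ac_eq_0_iff)
      have c: "(1 / \<mu>) ^ (d * q i) \<noteq> 0" using \<open>\<mu> \<noteq> 0\<close> by simp
      have "u ((1 / \<mu>) ^ (d * q i)) = real (d * q i) * u (1 / \<mu>)"
        using \<open>\<mu> \<noteq> 0\<close> by (intro log_hom_power[OF u_mult]) auto
      also have "u (1 / \<mu>) = - (u lam / 2)"
        using log_hom_divide[OF u_mult \<open>\<mu> \<noteq> 0\<close>] u_\<mu> by simp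
      finally have "u ((1 / \<mu>) ^ (d * q i) * int_to_ac (x i)) =
          p_exponent p (x i) - real (d * q i) * (u lam / 2)"
        using u_mult[OF c X] u_int[OF i(2)] by simp
      moreover have nz: "(1 / \<mu>) ^ (d * q i) * int_to_ac (x i) \<noteq> 0"
        using c X by (simp only: mult_eq_0_iff simp_thms)
      ultimately show ?thesis unfolding eq vu[OF nz] by (simp only:)
    qed
    show "semistable_at (v p) d n \<xi> (form_subst M (Poly_Mapping.map int_to_ac f))"
    proof (cases "\<forall>i\<le>n. p dvd x i")
      case True
      then obtain p0 where p0: "p0 \<in> P" "p dvd p0" "p0 dvd p" using ex1_implies_ex[OF P_ex1[OF p True]] by (elim exE conjE)
      \<comment> \<open>If \<open>p\<close> divided another member \<open>p'\<close>, then
        \<open>p0\<close>, which divides \<open>p\<close>, would divide it too, and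
        \<open>P_assoc\<close> would give \<open>p' = p0\<close>. So only \<open>p0\<close>
        contributes to \<open>u lam\<close>.\<close>
      have "p_exponent p p' = 0" if "p' \<in> P" "p' \<noteq> p0" for p'
        using P_assoc[OF p0(1) that(1)] that(2) dvd_trans[OF p0(3)] by (intro p_exponent_0) blast
      then have "u lam = (\<Sum>p'\<in>{p0}. of_rat (r p') * p_exponent p p')"
        unfolding u_lam using p0(1) fin by (intro sum.mono_neutral_right) auto
      moreover have "p_exponent p p0 = 1"
        using p_exponent_cong[OF p0(2,3), of p0] p_exponent_self[of p0] P[OF p0(1)] by simp
      ultimately have "u lam = 2 * \<alpha> p0 / (d * q (j p0))"
        by (simp add: r[OF p0(1)] of_rat_divide of_rat_mult)
      \<comment> \<open>The factor \<open>d * q (j p0)\<close> is nonzero and cancels, so the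
        coordinate \<open>j p0\<close> of the new form has valuation exactly 0.\<close>
      then have "real (d * q (j p0)) * (u lam / 2) = \<alpha> p0"
        using q[of "j p0"] j[OF p0(1)] assms(3) by simp
      moreover have "p_exponent p (x (j p0)) = \<alpha> p0"
        using p_exponent_cong[OF p0(2,3)] j[OF p0(1)] by simp
      ultimately show ?thesis
        unfolding semistable_at_def using j[OF p0(1)] val_M[of "j p0"]
        by (intro exI[of _ "j p0"]) simp
    next
      case False
      then obtain i where i: "i \<le> n" "\<not> p dvd x i" by blast
      \<comment> \<open>Every member of \<open>P\<close> divides \<open>x i\<close>, while
        \<open>p\<close> does not; hence \<open>p\<close> divides no member of \<open>P\<close>, and
        \<open>lam\<close> has valuation 0.\<close>
      have "p_exponent p p' = 0" if "p' \<in> P" for p'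
        using P[OF that] i dvd_trans[of p p'] by (intro p_exponent_0) blast
      then have "u lam = 0" by (simp add: u_lam)
      moreover have "x i \<noteq> 0" using i by auto
      ultimately show ?thesis
        unfolding semistable_at_def using i val_M[of i] p_exponent_0[of p "x i"]
        by (intro exI[of _ i]) simp
    qed
  qed
qed

end
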